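(* Let $P:\mathbb C^{\mathrm{op}}\to\mathbf{Pos}$ be a primary doctrine, $X$ an object of $\mathbb C$ and $\varphi\in P(X)$, and let $P_{(X,\varphi)}$ be the associated Kleisli doctrine with canonical 1-arrow $(F_X,\mathfrak f):P\to P_{(X,\varphi)}$. If $P$ is a $*$-autonomous doctrine, then $P_{(X,\varphi)}$ is a $*$-autonomous doctrine, and $(F_X,\mathfrak f)$ is a $*$-autonomous homomorphism.
   Context: A doctrine is a functor $P:\mathbb C^{\mathrm{op}}\to\mathbf{Pos}$ with $\mathbb C$ a category with finite products and $\mathbf{Pos}$ the category of posets and monotone maps; the maps $P(f)$ are called reindexings. It is primary if every $P(A)$ has finite meets ($\wedge$, $\top$) and all reindexings preserve them. A 1-arrow (doctrine homomorphism) from $P:\mathbb C^{\mathrm{op}}\to\mathbf{Pos}$ to $R:\mathbb D^{\mathrm{op}}\to\mathbf{Pos}$ is a pair $(F,\mathfrak f)$ with $F:\mathbb C\to\mathbb D$ a finite-product-preserving functor and $\mathfrak f:P\to R\circ F^{\mathrm{op}}$ natural; it is primary if $P,R$ are primary and each $\mathfrak f_A$ preserves finite meets. A primary doctrine $P$ is $*$-autonomous if each $P(A)$ is endowed with an operation $\neg$ such that $\neg\neg a=a$ for all $a\in P(A)$ and, for all $a,b,c\in P(A)$, $a\wedge b\le\neg c$ if and only if $a\le\neg(b\wedge c)$; moreover $\neg:P^{\mathrm{op}}\to P$ is a natural transformation (each $\neg$ is order-reversing and commutes with reindexings). A primary homomorphism between $*$-autonomous doctrines is $*$-autonomous if it preserves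 $\neg$. Kleisli doctrine (the Kleisli object of the comonad on $P$ given by $X\times-$ and $\alpha\mapsto P(\mathrm{pr}_1)(\varphi)\wedge P(\mathrm{pr}_2)(\alpha)$). The category $\mathbb C_X$ has the same objects as $\mathbb C$; an arrow $g:A\rightsquigarrow B$ in $\mathbb C_X$ is a $\mathbb C$-arrow $g:X\times A\to B$; the identity of $A$ is $\mathrm{pr}_2:X\times A\to A$; the composite of $g:A\rightsquigarrow B$ and $h:B\rightsquigarrow C$ is $h\langle\mathrm{pr}_1,g\rangle$. It has finite products, given on objects by those of $\mathbb C$. The doctrine $P_{(X,\varphi)}:\mathbb C_X^{\mathrm{op}}\to\mathbf{Pos}$ has $P_{(X,\varphi)}(A)=\{\alpha\in P(X\times A)\mid\alpha\le P(\mathrm{pr}_1)(\varphi)\}$ with the order of $P(X\times A)$, and reindexing along $g:A\rightsquigarrow B$ is the restriction of $P(\langle\mathrm{pr}_1,g\rangle)$. The 1-arrow $(F_X,\mathfrak f):P\to P_{(X,\varphi)}$: $F_X:\mathbb C\to\mathbb C_X$ is the identity on objects and sends $f:A\to B$ to $f\,\mathrm{pr}_2:A\rightsquigarrow B$; $\mathfrak f_A(\alpha)=P(\mathrm{pr}_1)(\varphi)\wedge P(\mathrm{pr}_2)(\alpha)$, for $\mathrm{pr}_1,\mathrm{pr}_2$ the projections from $X\times A$. The $*$-autonomous structure on $P_{(X,\varphi)}$ is given, for $\alpha\in P_{(X,\varphi)}(A)$, by the negation $\neg\alpha\wedge P(\mathrm{pr}_1)(\varphi)$, with $\neg$ and $\wedge$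 computed in $P(X\times A)$. *)

theory Defs
  imports "HOL-Algebra.Lattice" "HOL-Library.FuncSet"
begin

text \<open>
  Hom-sets are indexed by source and target and need not be disjoint, so composition takes the
  three objects as arguments: \<open>Comp C A B D g f\<close> is the composite of \<open>f : A \<rightarrow> B\<close> and
  \<open>g : B \<rightarrow> D\<close>.  Consequently an arrow of the Kleisli category from \<open>A\<close> to \<open>B\<close> can literally be an
  arrow of the original category from \<open>X \<times> A\<close> to \<open>B\<close>.  A terminal object and binary products are
  chosen; pairing is derived from the universal property.
\<close>

record ('o, 'a) cat_data =
  Obj :: "'o set"
  Hom :: "'o \<Rightarrow> 'o \<Rightarrow> 'a set"
  Id :: "'o \<Rightarrow> 'a"
  Comp :: "'o \<Rightarrow> 'o \<Rightarrow> 'o \<Rightarrow> 'a \<Rightarrow> 'a \<Rightarrow> 'a"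
  One :: "'o"
  Prod :: "'o \<Rightarrow> 'o \<Rightarrow> 'o"
  Pr1 :: "'o \<Rightarrow> 'o \<Rightarrow> 'a"
  Pr2 :: "'o \<Rightarrow> 'o \<Rightarrow> 'a"

definition is_terminal :: "('o, 'a) cat_data \<Rightarrow> 'o \<Rightarrow> bool" where
  "is_terminal C T \<longleftrightarrow> T \<in> Obj C \<and> (\<forall>Z\<in>Obj C. \<exists>!h. h \<in> Hom C Z T)"

definition is_product :: "('o, 'a) cat_data \<Rightarrow> 'o \<Rightarrow> 'o \<Rightarrow> 'o \<Rightarrow> 'a \<Rightarrow> 'a \<Rightarrow> bool" where
  "is_product C A B Q p q \<longleftrightarrow>
     A \<in> Obj C \<and> B \<in> Obj C \<and> Q \<in> Obj C \<and> p \<in> Hom C Q A \<and> q \<in> Hom C Q B \<and>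
     (\<forall>Z\<in>Obj C. \<forall>f\<in>Hom C Z A. \<forall>g\<in>Hom C Z B.
        \<exists>!h. h \<in> Hom C Z Q \<and> Comp C Z Q A p h = f \<and> Comp C Z Q B q h = g)"

locale finite_product_category =
  fixes C :: "('o, 'a) cat_data"
  assumes Id_closed: "A \<in> Obj C \<Longrightarrow> Id C A \<in> Hom C A A"
    and Comp_closed:
      "\<lbrakk>A \<in> Obj C; B \<in> Obj C; D \<in> Obj C; f \<in> Hom C A B; g \<in> Hom C B D\<rbrakk>
        \<Longrightarrow> Comp C A B D g f \<in> Hom C A D"
    and Id_left: "\<lbrakk>A \<in> Obj C; B \<in> Obj C; f \<in> Hom C A B\<rbrakk> \<Longrightarrow> Comp C A B B (Id C B) f = f"
    and Id_right: "\<lbrakk>A \<in> Obj C; B \<in> Obj C; f \<in> Hom C A B\<rbrakk> \<Longrightarrow> Comp C A A B f (Id C A) = f"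
    and Comp_assoc:
      "\<lbrakk>A \<in> Obj C; B \<in> Obj C; D \<in> Obj C; E \<in> Obj C;
        f \<in> Hom C A B; g \<in> Hom C B D; h \<in> Hom C D E\<rbrakk>
        \<Longrightarrow> Comp C A D E h (Comp C A B D g f) = Comp C A B E (Comp C B D E h g) f"
    and One_terminal: "is_terminal C (One C)"
    and Prod_product:
      "\<lbrakk>A \<in> Obj C; B \<in> Obj C\<rbrakk> \<Longrightarrow> is_product C A B (Prod C A B) (Pr1 C A B) (Pr2 C A B)"

definition pairing :: "('o, 'a) cat_data \<Rightarrow> 'o \<Rightarrow> 'o \<Rightarrow> 'o \<Rightarrow> 'a \<Rightarrow> 'a \<Rightarrow> 'a" where
  "pairing C Z A B f g = (THE h. h \<in> Hom C Z (Prod C A B) \<and>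
     Comp C Z (Prod C A B) A (Pr1 C A B) h = f \<and> Comp C Z (Prod C A B) B (Pr2 C A B) h = g)"

record ('o, 'a, 'u, 'b) functor_data =
  ObjMap :: "'o \<Rightarrow> 'u"
  ArrMap :: "'o \<Rightarrow> 'o \<Rightarrow> 'a \<Rightarrow> 'b"

locale finite_product_functor =
  C: finite_product_category C + D: finite_product_category D
  for C :: "('o, 'a) cat_data" and D :: "('u, 'b) cat_data" +
  fixes F :: "('o, 'a, 'u, 'b) functor_data"
  assumes ObjMap_closed: "A \<in> Obj C \<Longrightarrow> ObjMap F A \<in> Obj D"
    and ArrMap_closed:
      "\<lbrakk>A \<in> Obj C; B \<in> Obj C; f \<in> Hom C A B\<rbrakk>
        \<Longrightarrow> ArrMap F A B f \<in> Hom D (ObjMap F A) (ObjMap F B)"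
    and ArrMap_Id: "A \<in> Obj C \<Longrightarrow> ArrMap F A A (Id C A) = Id D (ObjMap F A)"
    and ArrMap_Comp:
      "\<lbrakk>A \<in> Obj C; B \<in> Obj C; E \<in> Obj C; f \<in> Hom C A B; g \<in> Hom C B E\<rbrakk>
        \<Longrightarrow> ArrMap F A E (Comp C A B E g f) =
            Comp D (ObjMap F A) (ObjMap F B) (ObjMap F E) (ArrMap F B E g) (ArrMap F A B f)"
    and preserves_terminal: "is_terminal C T \<Longrightarrow> is_terminal D (ObjMap F T)"
    and preserves_product:
      "is_product C A B Q p q \<Longrightarrow>
        is_product D (ObjMap F A) (ObjMap F B) (ObjMap F Q) (ArrMap F Q A p) (ArrMap F Q B q)"

text \<open>
  \<open>Reidx P A B f\<close> is the reindexing map from the fibre over \<open>B\<close> to the fibre over \<open>A\<close> along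
  \<open>f : A \<rightarrow> B\<close>.  The underlying equivalence of each fibre is equality, by \<^locale>\<open>partial_order\<close>.
\<close>

record ('o, 'a, 'p) doctrine_data =
  Base :: "('o, 'a) cat_data"
  Fib :: "'o \<Rightarrow> 'p gorder"
  Reidx :: "'o \<Rightarrow> 'o \<Rightarrow> 'a \<Rightarrow> 'p \<Rightarrow> 'p"

locale doctrine = finite_product_category "Base P"
  for P :: "('o, 'a, 'p) doctrine_data" +
  assumes Fib_poset: "A \<in> Obj (Base P) \<Longrightarrow> partial_order (Fib P A)"
    and Reidx_closed:
      "\<lbrakk>A \<in> Obj (Base P); B \<in> Obj (Base P); f \<in> Hom (Base P) A B\<rbrakk>
        \<Longrightarrow> Reidx P A B f \<in> carrier (Fib P B) \<rightarrow> carrier (Fib P A)"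
    and Reidx_mono:
      "\<lbrakk>A \<in> Obj (Base P); B \<in> Obj (Base P); f \<in> Hom (Base P) A B\<rbrakk>
        \<Longrightarrow> isotone (Fib P B) (Fib P A) (Reidx P A B f)"
    and Reidx_Id:
      "\<lbrakk>A \<in> Obj (Base P); a \<in> carrier (Fib P A)\<rbrakk> \<Longrightarrow> Reidx P A A (Id (Base P) A) a = a"
    and Reidx_Comp:
      "\<lbrakk>A \<in> Obj (Base P); B \<in> Obj (Base P); D \<in> Obj (Base P);
        f \<in> Hom (Base P) A B; g \<in> Hom (Base P) B D; d \<in> carrier (Fib P D)\<rbrakk>
        \<Longrightarrow> Reidx P A D (Comp (Base P) A B D g f) d = Reidx P A B f (Reidx P B D g d)"

locale primary_doctrine = doctrine P
  for P :: "('o, 'a, 'p) doctrine_data" +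
  assumes Fib_meets: "A \<in> Obj (Base P) \<Longrightarrow> lower_semilattice (Fib P A)"
    and Fib_top: "A \<in> Obj (Base P) \<Longrightarrow> weak_partial_order_top (Fib P A)"
    and Reidx_meet:
      "\<lbrakk>A \<in> Obj (Base P); B \<in> Obj (Base P); f \<in> Hom (Base P) A B;
        a \<in> carrier (Fib P B); b \<in> carrier (Fib P B)\<rbrakk>
        \<Longrightarrow> Reidx P A B f (a \<sqinter>\<^bsub>Fib P B\<^esub> b) = Reidx P A B f a \<sqinter>\<^bsub>Fib P A\<^esub> Reidx P A B f b"
    and Reidx_top:
      "\<lbrakk>A \<in> Obj (Base P); B \<in> Obj (Base P); f \<in> Hom (Base P) A B\<rbrakk>
        \<Longrightarrow> Reidx P A B f \<top>\<^bsub>Fib P B\<^esub> = \<top>\<^bsub>Fib P A\<^esub>"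

locale doctrine_homomorphism =
  P: doctrine P + R: doctrine R + finite_product_functor "Base P" "Base R" F
  for P :: "('o, 'a, 'p) doctrine_data" and R :: "('u, 'b, 'q) doctrine_data"
    and F :: "('o, 'a, 'u, 'b) functor_data" +
  fixes ff :: "'o \<Rightarrow> 'p \<Rightarrow> 'q"
  assumes ff_closed:
      "A \<in> Obj (Base P) \<Longrightarrow> ff A \<in> carrier (Fib P A) \<rightarrow> carrier (Fib R (ObjMap F A))"
    and ff_mono: "A \<in> Obj (Base P) \<Longrightarrow> isotone (Fib P A) (Fib R (ObjMap F A)) (ff A)"
    and ff_natural:
      "\<lbrakk>A \<in> Obj (Base P); B \<in> Obj (Base P); f \<in> Hom (Base P) A B; b \<in> carrier (Fib P B)\<rbrakk>
        \<Longrightarrow> ff A (Reidx P A B f b) =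
            Reidx R (ObjMap F A) (ObjMap F B) (ArrMap F A B f) (ff B b)"

locale primary_homomorphism =
  doctrine_homomorphism P R F ff + P: primary_doctrine P + R: primary_doctrine R
  for P :: "('o, 'a, 'p) doctrine_data" and R :: "('u, 'b, 'q) doctrine_data"
    and F :: "('o, 'a, 'u, 'b) functor_data" and ff :: "'o \<Rightarrow> 'p \<Rightarrow> 'q" +
  assumes ff_meet:
      "\<lbrakk>A \<in> Obj (Base P); a \<in> carrier (Fib P A); b \<in> carrier (Fib P A)\<rbrakk>
        \<Longrightarrow> ff A (a \<sqinter>\<^bsub>Fib P A\<^esub> b) = ff A a \<sqinter>\<^bsub>Fib R (ObjMap F A)\<^esub> ff A b"
    and ff_top: "A \<in> Obj (Base P) \<Longrightarrow> ff A \<top>\<^bsub>Fib P A\<^esub> = \<top>\<^bsub>Fib R (ObjMap F A)\<^esub>"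

locale star_autonomous_doctrine = primary_doctrine P
  for P :: "('o, 'a, 'p) doctrine_data" +
  fixes neg :: "'o \<Rightarrow> 'p \<Rightarrow> 'p"
  assumes neg_closed: "A \<in> Obj (Base P) \<Longrightarrow> neg A \<in> carrier (Fib P A) \<rightarrow> carrier (Fib P A)"
    and neg_neg: "\<lbrakk>A \<in> Obj (Base P); a \<in> carrier (Fib P A)\<rbrakk> \<Longrightarrow> neg A (neg A a) = a"
    and neg_meet:
      "\<lbrakk>A \<in> Obj (Base P); a \<in> carrier (Fib P A); b \<in> carrier (Fib P A); c \<in> carrier (Fib P A)\<rbrakk>
        \<Longrightarrow> a \<sqinter>\<^bsub>Fib P A\<^esub> b \<sqsubseteq>\<^bsub>Fib P A\<^esub> neg A c \<longleftrightarrow> a \<sqsubseteq>\<^bsub>Fib P A\<^esub> neg A (b \<sqinter>\<^bsub>Fib P A\<^esub> c)"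
    and neg_antitone: "A \<in> Obj (Base P) \<Longrightarrow> isotone (inv_gorder (Fib P A)) (Fib P A) (neg A)"
    and neg_natural:
      "\<lbrakk>A \<in> Obj (Base P); B \<in> Obj (Base P); f \<in> Hom (Base P) A B; b \<in> carrier (Fib P B)\<rbrakk>
        \<Longrightarrow> neg A (Reidx P A B f b) = Reidx P A B f (neg B b)"

locale star_autonomous_homomorphism =
  primary_homomorphism P R F ff + P: star_autonomous_doctrine P neg +
  R: star_autonomous_doctrine R neg'
  for P :: "('o, 'a, 'p) doctrine_data" and neg :: "'o \<Rightarrow> 'p \<Rightarrow> 'p"
    and R :: "('u, 'b, 'q) doctrine_data" and neg' :: "'u \<Rightarrow> 'q \<Rightarrow> 'q"
    and F :: "('o, 'a, 'u, 'b) functor_data" and ff :: "'o \<Rightarrow> 'p \<Rightarrow> 'q" +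
  assumes ff_neg:
      "\<lbrakk>A \<in> Obj (Base P); a \<in> carrier (Fib P A)\<rbrakk>
        \<Longrightarrow> ff A (neg A a) = neg' (ObjMap F A) (ff A a)"

definition kleisli_graph :: "('o, 'a) cat_data \<Rightarrow> 'o \<Rightarrow> 'o \<Rightarrow> 'o \<Rightarrow> 'a \<Rightarrow> 'a" where
  "kleisli_graph C X A B g = pairing C (Prod C X A) X B (Pr1 C X A) g"
  \<comment> \<open>\<open>\<langle>pr\<^sub>1, g\<rangle> : X \<times> A \<rightarrow> X \<times> B\<close> for \<open>g : X \<times> A \<rightarrow> B\<close>\<close>

definition kleisli_category :: "('o, 'a) cat_data \<Rightarrow> 'o \<Rightarrow> ('o, 'a) cat_data" where
  "kleisli_category C X = \<lparr>
     Obj = Obj C,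
     Hom = (\<lambda>A B. Hom C (Prod C X A) B),
     Id = (\<lambda>A. Pr2 C X A),
     Comp = (\<lambda>A B D h g. Comp C (Prod C X A) (Prod C X B) D h (kleisli_graph C X A B g)),
     One = One C,
     Prod = Prod C,
     Pr1 = (\<lambda>A B. Comp C (Prod C X (Prod C A B)) (Prod C A B) A (Pr1 C A B) (Pr2 C X (Prod C A B))),
     Pr2 = (\<lambda>A B. Comp C (Prod C X (Prod C A B)) (Prod C A B) B (Pr2 C A B) (Pr2 C X (Prod C A B)))\<rparr>"

definition kleisli_weaken :: "('o, 'a, 'p) doctrine_data \<Rightarrow> 'o \<Rightarrow> 'p \<Rightarrow> 'o \<Rightarrow> 'p" where
  "kleisli_weaken P X \<phi> A = Reidx P (Prod (Base P) X A) X (Pr1 (Base P) X A) \<phi>"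
  \<comment> \<open>\<open>P(pr\<^sub>1)(\<phi>)\<close>, an element of \<open>P(X \<times> A)\<close>\<close>

definition kleisli_doctrine ::
  "('o, 'a, 'p) doctrine_data \<Rightarrow> 'o \<Rightarrow> 'p \<Rightarrow> ('o, 'a, 'p) doctrine_data" where
  "kleisli_doctrine P X \<phi> = \<lparr>
     Base = kleisli_category (Base P) X,
     Fib = (\<lambda>A. (Fib P (Prod (Base P) X A))
       \<lparr>carrier := {\<alpha> \<in> carrier (Fib P (Prod (Base P) X A)).
                      \<alpha> \<sqsubseteq>\<^bsub>Fib P (Prod (Base P) X A)\<^esub> kleisli_weaken P X \<phi> A}\<rparr>),
     Reidx = (\<lambda>A B g. Reidx P (Prod (Base P) X A) (Prod (Base P) X B)
                        (kleisli_graph (Base P) X A B g))\<rparr>"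

definition kleisli_functor :: "('o, 'a) cat_data \<Rightarrow> 'o \<Rightarrow> ('o, 'a, 'o, 'a) functor_data" where
  "kleisli_functor C X = \<lparr>
     ObjMap = (\<lambda>A. A),
     ArrMap = (\<lambda>A B f. Comp C (Prod C X A) A B f (Pr2 C X A))\<rparr>"

definition kleisli_unit :: "('o, 'a, 'p) doctrine_data \<Rightarrow> 'o \<Rightarrow> 'p \<Rightarrow> 'o \<Rightarrow> 'p \<Rightarrow> 'p" where
  "kleisli_unit P X \<phi> A \<alpha> =
     kleisli_weaken P X \<phi> A \<sqinter>\<^bsub>Fib P (Prod (Base P) X A)\<^esub>
     Reidx P (Prod (Base P) X A) A (Pr2 (Base P) X A) \<alpha>"

definition kleisli_neg ::
  "('o, 'a, 'p) doctrine_data \<Rightarrow> ('o \<Rightarrow> 'p \<Rightarrow> 'p) \<Rightarrow> 'o \<Rightarrow> 'p \<Rightarrow> 'o \<Rightarrow> 'p \<Rightarrow> 'p" where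
  "kleisli_neg P neg X \<phi> A \<alpha> =
     neg (Prod (Base P) X A) \<alpha> \<sqinter>\<^bsub>Fib P (Prod (Base P) X A)\<^esub> kleisli_weaken P X \<phi> A"

end

theory Submission
  imports Defs
begin

text \<open>
  Each fibre of a \<open>*\<close>-autonomous doctrine is a Boolean algebra in disguise, since \<open>a \<sqsubseteq> \<not>b\<close> says that
  \<open>a \<sqinter> b\<close> is below the bottom element \<open>\<not>\<top>\<close>.  The Kleisli fibre over \<open>A\<close> is the principal ideal
  below \<open>P(pr\<^sub>1)(\<phi>)\<close>, with meets inherited and negation relativised.  All categorical identities
  reduce to the description of \<open>\<langle>pr\<^sub>1, g\<rangle>\<close> as the unique arrow over \<open>X\<close> with second component \<open>g\<close>;
  in particular reindexing along it carries \<open>P(pr\<^sub>1)(\<phi>)\<close> to \<open>P(pr\<^sub>1)(\<phi>)\<close>.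
\<close>

section \<open>Principal ideals\<close>

abbreviation ideal_below :: "('p, 'e) gorder_scheme \<Rightarrow> 'p \<Rightarrow> ('p, 'e) gorder_scheme" where
  "ideal_below L w \<equiv> L\<lparr>carrier := {a \<in> carrier L. a \<sqsubseteq>\<^bsub>L\<^esub> w}\<rparr>"

text \<open>\<open>\<top>\<close> is a Hilbert choice among the greatest elements, and antisymmetry
  leaves only one candidate. This gives a known value to the top of an ideal, which is chosen over a
  smaller carrier.\<close>

lemma (in partial_order) top_eqI:
  assumes "t \<in> carrier L" and "\<And>a. a \<in> carrier L \<Longrightarrow> a \<sqsubseteq> t"
  shows "\<top> = t"
  unfolding top_def
proof (rule some_equality)
  show "greatest L t (carrier L)"
    using assms by (simp add: greatest_def)
  then show "x = t" if "greatest L x (carrier L)" for x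
    using that greatest_unique by blast
qed

lemma (in lower_semilattice) meet_eqI:
  assumes "a \<in> carrier L" "b \<in> carrier L" "m \<in> carrier L" "m \<sqsubseteq> a" "m \<sqsubseteq> b"
    and "\<And>x. \<lbrakk>x \<in> carrier L; x \<sqsubseteq> a; x \<sqsubseteq> b\<rbrakk> \<Longrightarrow> x \<sqsubseteq> m"
  shows "a \<sqinter> b = m"
  using assms by (metis le_antisym meet_closed meet_le meet_left meet_right)

lemma (in lower_semilattice) le_meet_iff:
  assumes "a \<in> carrier L" "b \<in> carrier L" "x \<in> carrier L"
  shows "x \<sqsubseteq> a \<sqinter> b \<longleftrightarrow> x \<sqsubseteq> a \<and> x \<sqsubseteq> b"
  using assms by (meson le_trans meet_closed meet_le meet_left meet_right)

text \<open>Idempotence of \<open>w\<close> lets both factors share it. With \<open>w\<close> the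
  weakened \<phi>, this is why the unit preserves binary meets.\<close>

lemma (in lower_semilattice) meet_distrib_left:
  assumes "w \<in> carrier L" "a \<in> carrier L" "b \<in> carrier L"
  shows "w \<sqinter> (a \<sqinter> b) = (w \<sqinter> a) \<sqinter> (w \<sqinter> b)"
proof (rule meet_eqI[symmetric])
  show "w \<sqinter> (a \<sqinter> b) \<sqsubseteq> w \<sqinter> a" "w \<sqinter> (a \<sqinter> b) \<sqsubseteq> w \<sqinter> b"
    using assms le_trans[OF meet_right[of w "a \<sqinter> b"]]
    by (simp_all add: le_meet_iff meet_left meet_right)
qed (use assms in \<open>simp_all add: le_meet_iff\<close>)

lemma (in partial_order) ideal_below_partial_order: "partial_order (ideal_below L w)"
proof -
  have "weak_partial_order (ideal_below L w)"
    by (rule weak_partial_order_subset) (auto simp: weak_partial_order_axioms)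
  then show ?thesis
    by (simp add: partial_order_def partial_order_axioms_def eq_is_equal)
qed

lemma (in partial_order) top_ideal_below:
  assumes "w \<in> carrier L"
  shows "\<top>\<^bsub>ideal_below L w\<^esub> = w"
proof -
  interpret I: partial_order "ideal_below L w"
    by (rule ideal_below_partial_order)
  show ?thesis
    by (rule I.top_eqI) (use assms in auto)
qed

lemma (in partial_order) ideal_below_top:
  assumes "w \<in> carrier L"
  shows "weak_partial_order_top (ideal_below L w)"
proof -
  interpret I: partial_order "ideal_below L w"
    by (rule ideal_below_partial_order)
  show ?thesis
    by unfold_locales (use assms in \<open>auto simp: greatest_def\<close>)
qed

text \<open>The ideal is closed downwards, so the ambient meet of two members lies in it and is
  still their greatest lower bound there.\<close>

lemma (in lower_semilattice) ideal_below_lower_semilattice: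
  assumes "w \<in> carrier L"
  shows "lower_semilattice (ideal_below L w)"
proof -
  interpret I: partial_order "ideal_below L w"
    by (rule ideal_below_partial_order)
  show ?thesis
  proof
    fix a b
    assume ab: "a \<in> carrier (ideal_below L w)" "b \<in> carrier (ideal_below L w)"
    then have "a \<sqinter> b \<sqsubseteq> w"
      using assms by (auto intro: le_trans[OF meet_left])
    with ab have "greatest (ideal_below L w) (a \<sqinter> b) (Lower (ideal_below L w) {a, b})"
      by (auto simp: greatest_def Lower_def meet_left meet_right meet_le)
    then show "\<exists>s. greatest (ideal_below L w) s (Lower (ideal_below L w) {a, b})" ..
  qed
qed

text \<open>The meet in the ideal is a separate choice made over a smaller carrier, so it has to be
  identified with the ambient one. Calculations in a Kleisli fibre can then be carried out in the
  ambient fibre.\<close>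

lemma (in lower_semilattice) meet_ideal_below:
  assumes "w \<in> carrier L" "a \<in> carrier (ideal_below L w)" "b \<in> carrier (ideal_below L w)"
  shows "a \<sqinter>\<^bsub>ideal_below L w\<^esub> b = a \<sqinter> b"
proof -
  interpret I: lower_semilattice "ideal_below L w"
    by (rule ideal_below_lower_semilattice) fact
  have "a \<sqinter> b \<sqsubseteq> w"
    using assms by (auto intro: le_trans[OF meet_left])
  then show ?thesis
    by (intro I.meet_eqI) (use assms in \<open>auto intro: meet_left meet_right meet_le\<close>)
qed

section \<open>Relativised negation\<close>

text \<open>A single fibre without its reindexings: the laws of relativised negation are semilattice
  algebra and can be settled apart from any category.\<close>

locale star_autonomous_semilattice = lower_semilattice L for L (structure) +
  fixes n :: "'a \<Rightarrow> 'a"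
  assumes n_closed [simp]: "a \<in> carrier L \<Longrightarrow> n a \<in> carrier L"
    and n_n [simp]: "a \<in> carrier L \<Longrightarrow> n (n a) = a"
    and meet_le_n: "\<lbrakk>a \<in> carrier L; b \<in> carrier L; c \<in> carrier L\<rbrakk>
      \<Longrightarrow> a \<sqinter> b \<sqsubseteq> n c \<longleftrightarrow> a \<sqsubseteq> n (b \<sqinter> c)"
    and n_antitone: "\<lbrakk>a \<in> carrier L; b \<in> carrier L; a \<sqsubseteq> b\<rbrakk> \<Longrightarrow> n b \<sqsubseteq> n a"
begin

text \<open>The Boolean identity (\<not>w \<or> \<not>a) \<and> w = \<not>a \<and> w in a form free
  of joins. Moving \<open>w\<close> across with \<open>meet_le_n\<close> turns the first inequality
  into reflexivity; antitonicity gives the second. Both relative double negation and preservation of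
  negation by the unit rest on it.\<close>

lemma meet_relative_neg:
  assumes [simp]: "a \<in> carrier L" "w \<in> carrier L"
  shows "n (w \<sqinter> a) \<sqinter> w = n a \<sqinter> w"
proof (rule le_antisym)
  have "n (w \<sqinter> a) \<sqinter> w \<sqsubseteq> n a"
    by (simp add: meet_le_n)
  then show "n (w \<sqinter> a) \<sqinter> w \<sqsubseteq> n a \<sqinter> w"
    by (simp add: le_meet_iff meet_right)
  have "n a \<sqsubseteq> n (w \<sqinter> a)"
    by (simp add: n_antitone meet_right)
  from le_trans[OF meet_left this] have "n a \<sqinter> w \<sqsubseteq> n (w \<sqinter> a)"
    by simp
  then show "n a \<sqinter> w \<sqsubseteq> n (w \<sqinter> a) \<sqinter> w"
    by (simp add: le_meet_iff meet_right)
qed simp_all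

text \<open>Applying \<open>meet_relative_neg\<close> to \<open>n a\<close> removes the inner
  \<open>w\<close> and leaves the double negation of \<open>a\<close> met with \<open>w\<close>,
  which is \<open>a\<close> because \<open>a\<close> lies below \<open>w\<close>.\<close>

lemma relative_neg_neg:
  assumes [simp]: "a \<in> carrier L" "w \<in> carrier L" and "a \<sqsubseteq> w"
  shows "n (n a \<sqinter> w) \<sqinter> w = a"
proof -
  have "n (n a \<sqinter> w) \<sqinter> w = a \<sqinter> w"
    using meet_relative_neg[of "n a" w] by (simp add: meet_comm[of L "n a"])
  also have "\<dots> = a"
    by (rule meet_eqI) (use assms in auto)
  finally show ?thesis .
qed

text \<open>Since \<open>a\<close> lies below \<open>w\<close>, the bound by \<open>w\<close> holds
  automatically on both sides, and what remains is \<open>meet_le_n\<close>.\<close>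

lemma meet_le_relative_neg:
  assumes [simp]: "a \<in> carrier L" "b \<in> carrier L" "c \<in> carrier L" "w \<in> carrier L"
    and aw: "a \<sqsubseteq> w"
  shows "a \<sqinter> b \<sqsubseteq> n c \<sqinter> w \<longleftrightarrow> a \<sqsubseteq> n (b \<sqinter> c) \<sqinter> w"
proof -
  have "a \<sqinter> b \<sqsubseteq> w"
    by (rule le_trans[OF meet_left]) (use aw in auto)
  then show ?thesis
    using aw by (simp add: le_meet_iff meet_le_n)
qed

lemma relative_neg_antitone:
  assumes [simp]: "a \<in> carrier L" "b \<in> carrier L" "w \<in> carrier L" and "a \<sqsubseteq> b"
  shows "n b \<sqinter> w \<sqsubseteq> n a \<sqinter> w"
  using le_trans[OF meet_left[of "n b" w] n_antitone] assms(4)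
  by (simp add: le_meet_iff meet_right)

end

lemma (in star_autonomous_doctrine) Fib_star_autonomous:
  assumes "A \<in> Obj (Base P)"
  shows "star_autonomous_semilattice (Fib P A) (neg A)"
proof -
  interpret lower_semilattice "Fib P A"
    using assms by (rule Fib_meets)
  show ?thesis
    by unfold_locales
      (use assms neg_closed neg_neg neg_meet neg_antitone[OF assms] in \<open>auto simp: isotone_def\<close>)
qed

section \<open>The Kleisli category\<close>

lemma (in finite_product_category) Prod_closed:
  "\<lbrakk>A \<in> Obj C; B \<in> Obj C\<rbrakk> \<Longrightarrow> Prod C A B \<in> Obj C"
  using Prod_product by (simp add: is_product_def)

lemma (in finite_product_category) Pr1_closed:
  "\<lbrakk>A \<in> Obj C; B \<in> Obj C\<rbrakk> \<Longrightarrow> Pr1 C A B \<in> Hom C (Prod C A B) A"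
  using Prod_product by (simp add: is_product_def)

lemma (in finite_product_category) Pr2_closed:
  "\<lbrakk>A \<in> Obj C; B \<in> Obj C\<rbrakk> \<Longrightarrow> Pr2 C A B \<in> Hom C (Prod C A B) B"
  using Prod_product by (simp add: is_product_def)

lemma (in finite_product_category) pairing_ex1:
  assumes "Z \<in> Obj C" "A \<in> Obj C" "B \<in> Obj C" "f \<in> Hom C Z A" "g \<in> Hom C Z B"
  shows "\<exists>!h. h \<in> Hom C Z (Prod C A B) \<and>
    Comp C Z (Prod C A B) A (Pr1 C A B) h = f \<and> Comp C Z (Prod C A B) B (Pr2 C A B) h = g"
  using Prod_product[OF assms(2,3)] assms unfolding is_product_def by blast

lemma (in finite_product_category) pairing:
  assumes "Z \<in> Obj C" "A \<in> Obj C" "B \<in> Obj C" "f \<in> Hom C Z A" "g \<in> Hom C Z B"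
  shows "pairing C Z A B f g \<in> Hom C Z (Prod C A B)"
    and "Comp C Z (Prod C A B) A (Pr1 C A B) (pairing C Z A B f g) = f"
    and "Comp C Z (Prod C A B) B (Pr2 C A B) (pairing C Z A B f g) = g"
  using theI'[OF pairing_ex1[OF assms]] unfolding pairing_def by blast+

text \<open>The components \<open>f\<close> and \<open>g\<close> need no typing assumptions: as
  composites of \<open>h\<close> with the projections they inherit their hom-sets from it.\<close>

lemma (in finite_product_category) pairing_eqI:
  assumes "Z \<in> Obj C" "A \<in> Obj C" "B \<in> Obj C" "h \<in> Hom C Z (Prod C A B)"
    and "Comp C Z (Prod C A B) A (Pr1 C A B) h = f"
    and "Comp C Z (Prod C A B) B (Pr2 C A B) h = g"
  shows "pairing C Z A B f g = h"
proof -
  have "f \<in> Hom C Z A" "g \<in> Hom C Z B"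
    using assms Comp_closed[OF assms(1) Prod_closed[OF assms(2,3)] _ assms(4)]
      Pr1_closed Pr2_closed by auto
  then show ?thesis
    unfolding pairing_def using assms by (intro the1_equality pairing_ex1) auto
qed

section \<open>Graphs of Kleisli arrows; only \<open>X\<close> enters the base category, \<phi>
  comes with the fibres\<close>

locale kleisli_base = finite_product_category C for C :: "('o, 'a) cat_data" +
  fixes X :: 'o
  assumes X_closed: "X \<in> Obj C"
begin

abbreviation times_X :: "'o \<Rightarrow> 'o" where
  "times_X \<equiv> Prod C X"

abbreviation graph :: "'o \<Rightarrow> 'o \<Rightarrow> 'a \<Rightarrow> 'a" where
  "graph \<equiv> kleisli_graph C X"

lemma times_X_closed [simp]: "A \<in> Obj C \<Longrightarrow> times_X A \<in> Obj C"
  using X_closed by (rule Prod_closed)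

lemma Pr1_X_closed [simp]: "A \<in> Obj C \<Longrightarrow> Pr1 C X A \<in> Hom C (times_X A) X"
  using X_closed by (rule Pr1_closed)

lemma Pr2_X_closed [simp]: "A \<in> Obj C \<Longrightarrow> Pr2 C X A \<in> Hom C (times_X A) A"
  using X_closed by (rule Pr2_closed)

lemma graph:
  assumes "A \<in> Obj C" "B \<in> Obj C" "g \<in> Hom C (times_X A) B"
  shows graph_closed: "graph A B g \<in> Hom C (times_X A) (times_X B)"
    and Pr1_graph: "Comp C (times_X A) (times_X B) X (Pr1 C X B) (graph A B g) = Pr1 C X A"
    and Pr2_graph: "Comp C (times_X A) (times_X B) B (Pr2 C X B) (graph A B g) = g"
  unfolding kleisli_graph_def using assms X_closed by (simp_all add: pairing)

lemma graph_eqI: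
  assumes "A \<in> Obj C" "B \<in> Obj C" "h \<in> Hom C (times_X A) (times_X B)"
    and "Comp C (times_X A) (times_X B) X (Pr1 C X B) h = Pr1 C X A"
    and "Comp C (times_X A) (times_X B) B (Pr2 C X B) h = g"
  shows "graph A B g = h"
  unfolding kleisli_graph_def using assms X_closed by (simp add: pairing_eqI)

lemma graph_Pr2:
  assumes "A \<in> Obj C"
  shows "graph A A (Pr2 C X A) = Id C (times_X A)"
  using assms X_closed by (intro graph_eqI) (simp_all add: Id_closed Id_right[of "times_X A"])

text \<open>Both sides are arrows over \<open>X\<close> with the same second component. Together
  with \<open>graph_Pr2\<close> this makes \<open>graph\<close> functorial from the Kleisli category
  to \<open>C\<close>, which yields associativity below and functoriality of reindexing
  later.\<close>

lemma graph_Comp_graph: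
  assumes "A \<in> Obj C" "B \<in> Obj C" "D \<in> Obj C"
    and "g \<in> Hom C (times_X A) B" "h \<in> Hom C (times_X B) D"
  shows "graph A D (Comp C (times_X A) (times_X B) D h (graph A B g)) =
    Comp C (times_X A) (times_X B) (times_X D) (graph B D h) (graph A B g)"
proof (rule graph_eqI)
  have gr: "graph A B g \<in> Hom C (times_X A) (times_X B)"
    "graph B D h \<in> Hom C (times_X B) (times_X D)"
    using assms by (simp_all add: graph_closed)
  then show "Comp C (times_X A) (times_X B) (times_X D) (graph B D h) (graph A B g)
      \<in> Hom C (times_X A) (times_X D)"
    using assms by (intro Comp_closed) simp_all
  show "Comp C (times_X A) (times_X D) X (Pr1 C X D)
      (Comp C (times_X A) (times_X B) (times_X D) (graph B D h) (graph A B g)) = Pr1 C X A"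
    using assms gr X_closed by (subst Comp_assoc) (simp_all add: Pr1_graph)
  show "Comp C (times_X A) (times_X D) D (Pr2 C X D)
      (Comp C (times_X A) (times_X B) (times_X D) (graph B D h) (graph A B g)) =
      Comp C (times_X A) (times_X B) D h (graph A B g)"
    using assms gr by (subst Comp_assoc) (simp_all add: Pr2_graph)
qed (use assms in auto)

text \<open>The second projection cancels against the graph, so Kleisli composition with an arrow in
  the image of the canonical functor is ordinary composition.\<close>

lemma Comp_Pr2_graph:
  assumes "A \<in> Obj C" "B \<in> Obj C" "D \<in> Obj C"
    and "g \<in> Hom C (times_X A) B" "h \<in> Hom C B D"
  shows "Comp C (times_X A) (times_X B) D (Comp C (times_X B) B D h (Pr2 C X B)) (graph A B g) =
    Comp C (times_X A) B D h g"
  using assms by (subst Comp_assoc[symmetric]) (simp_all add: graph_closed Pr2_graph)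

section \<open>Finite products in the Kleisli category and their preservation by the canonical
  functor\<close>

lemma is_terminal_kleisli:
  assumes "is_terminal C T"
  shows "is_terminal (kleisli_category C X) T"
  using assms by (auto simp: is_terminal_def kleisli_category_def)

text \<open>By \<open>Comp_Pr2_graph\<close>, the universal property at \<open>Z\<close> in the
  Kleisli category is the one at \<open>times_X Z\<close> in \<open>C\<close>. Arbitrary product
  cones are treated, so the lemma serves both the chosen products and the preservation of products
  by the functor.\<close>

lemma is_product_kleisli:
  assumes "is_product C A B Q p q"
  shows "is_product (kleisli_category C X) A B Q
    (Comp C (times_X Q) Q A p (Pr2 C X Q)) (Comp C (times_X Q) Q B q (Pr2 C X Q))"
proof -
  have objs: "A \<in> Obj C" "B \<in> Obj C" "Q \<in> Obj C"
    and legs: "p \<in> Hom C Q A" "q \<in> Hom C Q B"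
    using assms by (simp_all add: is_product_def)
  have univ: "\<exists>!h. h \<in> Hom C Z Q \<and> Comp C Z Q A p h = f \<and> Comp C Z Q B q h = g"
    if "Z \<in> Obj C" "f \<in> Hom C Z A" "g \<in> Hom C Z B" for Z f g
    using assms that by (simp add: is_product_def)
  have "Comp C (times_X Q) Q A p (Pr2 C X Q) \<in> Hom C (times_X Q) A"
    "Comp C (times_X Q) Q B q (Pr2 C X Q) \<in> Hom C (times_X Q) B"
    using objs legs by (auto intro: Comp_closed)
  moreover have "\<exists>!h. h \<in> Hom C (times_X Z) Q \<and>
      Comp C (times_X Z) (times_X Q) A (Comp C (times_X Q) Q A p (Pr2 C X Q)) (graph Z Q h) = f \<and>
      Comp C (times_X Z) (times_X Q) B (Comp C (times_X Q) Q B q (Pr2 C X Q)) (graph Z Q h) = g"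
    if Z: "Z \<in> Obj C" and f: "f \<in> Hom C (times_X Z) A" and g: "g \<in> Hom C (times_X Z) B" for Z f g
    \<comment> \<open>\<open>conj_cong\<close> makes the typing of \<open>h\<close> available while
      the two equations are rewritten; \<open>Comp_Pr2_graph\<close> requires it.\<close>
    using univ[OF times_X_closed[OF Z] f g] objs legs Z
    by (simp add: Comp_Pr2_graph cong: conj_cong)
  ultimately show ?thesis
    using objs by (simp add: is_product_def kleisli_category_def)
qed

lemma finite_product_category_kleisli: "finite_product_category (kleisli_category C X)"
proof
  fix A B
  assume "A \<in> Obj (kleisli_category C X)" "B \<in> Obj (kleisli_category C X)"
  then have "is_product C A B (Prod C A B) (Pr1 C A B) (Pr2 C A B)"
    by (intro Prod_product) (simp_all add: kleisli_category_def)
  from is_product_kleisli[OF this]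
  show "is_product (kleisli_category C X) A B (Prod (kleisli_category C X) A B)
      (Pr1 (kleisli_category C X) A B) (Pr2 (kleisli_category C X) A B)"
    by (simp add: kleisli_category_def)
next
  show "is_terminal (kleisli_category C X) (One (kleisli_category C X))"
    using is_terminal_kleisli[OF One_terminal] by (simp add: kleisli_category_def)
next
  fix A B D E f g h
  assume "A \<in> Obj (kleisli_category C X)" "B \<in> Obj (kleisli_category C X)"
    "D \<in> Obj (kleisli_category C X)" "E \<in> Obj (kleisli_category C X)"
    "f \<in> Hom (kleisli_category C X) A B" "g \<in> Hom (kleisli_category C X) B D"
    "h \<in> Hom (kleisli_category C X) D E"
  \<comment> \<open>Once the graph of the inner composite is split into a composite of graphs, this
    is associativity in \<open>C\<close>.\<close>
  then show "Comp (kleisli_category C X) A D E h (Comp (kleisli_category C X) A B D g f) =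
      Comp (kleisli_category C X) A B E (Comp (kleisli_category C X) B D E h g) f"
    by (simp add: kleisli_category_def graph_Comp_graph graph_closed Comp_assoc)
next
  fix A B D f g
  assume "A \<in> Obj (kleisli_category C X)" "B \<in> Obj (kleisli_category C X)"
    "D \<in> Obj (kleisli_category C X)"
    "f \<in> Hom (kleisli_category C X) A B" "g \<in> Hom (kleisli_category C X) B D"
  then show "Comp (kleisli_category C X) A B D g f \<in> Hom (kleisli_category C X) A D"
    by (simp add: kleisli_category_def graph_closed Comp_closed[of "times_X A" "times_X B"])
qed (simp_all add: kleisli_category_def Pr2_graph graph_Pr2 Id_right)

lemma finite_product_functor_kleisli:
  "finite_product_functor C (kleisli_category C X) (kleisli_functor C X)"
proof -
  interpret K: finite_product_category "kleisli_category C X"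
    by (rule finite_product_category_kleisli)
  show ?thesis
  proof
    fix A B Q p q
    assume "is_product C A B Q p q"
    from is_product_kleisli[OF this]
    show "is_product (kleisli_category C X) (ObjMap (kleisli_functor C X) A)
        (ObjMap (kleisli_functor C X) B) (ObjMap (kleisli_functor C X) Q)
        (ArrMap (kleisli_functor C X) Q A p) (ArrMap (kleisli_functor C X) Q B q)"
      by (simp add: kleisli_functor_def)
  next
    fix A B E f g
    assume *: "A \<in> Obj C" "B \<in> Obj C" "E \<in> Obj C" "f \<in> Hom C A B" "g \<in> Hom C B E"
    then have "Comp C (times_X A) A B f (Pr2 C X A) \<in> Hom C (times_X A) B"
      by (intro Comp_closed) simp_all
    with * show "ArrMap (kleisli_functor C X) A E (Comp C A B E g f) =
        Comp (kleisli_category C X) (ObjMap (kleisli_functor C X) A)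
          (ObjMap (kleisli_functor C X) B) (ObjMap (kleisli_functor C X) E)
          (ArrMap (kleisli_functor C X) B E g) (ArrMap (kleisli_functor C X) A B f)"
      by (simp add: kleisli_functor_def kleisli_category_def Comp_Pr2_graph Comp_assoc)
  qed (auto simp: kleisli_functor_def kleisli_category_def Id_left
    intro: Comp_closed is_terminal_kleisli[unfolded kleisli_category_def])
qed

end

section \<open>The Kleisli doctrine\<close>

locale kleisli_primary = primary_doctrine P for P :: "('o, 'a, 'p) doctrine_data" +
  fixes X :: 'o and \<phi> :: 'p
  assumes X_object: "X \<in> Obj (Base P)"
    and \<phi>_closed: "\<phi> \<in> carrier (Fib P X)"

sublocale kleisli_primary \<subseteq> kleisli_base "Base P" X
  by unfold_locales (rule X_object)

context kleisli_primary
begin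

abbreviation K :: "('o, 'a, 'p) doctrine_data" where
  "K \<equiv> kleisli_doctrine P X \<phi>"

abbreviation weaken :: "'o \<Rightarrow> 'p" where
  "weaken \<equiv> kleisli_weaken P X \<phi>"

lemma Base_K [simp]: "Base K = kleisli_category (Base P) X"
  by (simp add: kleisli_doctrine_def)

lemma Obj_kleisli [simp]: "Obj (kleisli_category (Base P) X) = Obj (Base P)"
  by (simp add: kleisli_category_def)

lemma Hom_kleisli [simp]: "Hom (kleisli_category (Base P) X) A B = Hom (Base P) (times_X A) B"
  by (simp add: kleisli_category_def)

lemma Fib_K: "Fib K A = ideal_below (Fib P (times_X A)) (weaken A)"
  by (simp add: kleisli_doctrine_def)

lemma Reidx_K: "Reidx K A B g = Reidx P (times_X A) (times_X B) (graph A B g)"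
  by (simp add: kleisli_doctrine_def)

lemma le_Fib_K [simp]: "a \<sqsubseteq>\<^bsub>Fib K A\<^esub> b \<longleftrightarrow> a \<sqsubseteq>\<^bsub>Fib P (times_X A)\<^esub> b"
  by (simp add: Fib_K)

lemma carrier_Fib_K [simp]:
  "a \<in> carrier (Fib K A) \<longleftrightarrow>
    a \<in> carrier (Fib P (times_X A)) \<and> a \<sqsubseteq>\<^bsub>Fib P (times_X A)\<^esub> weaken A"
  by (simp add: Fib_K)

lemma Reidx_mem:
  "\<lbrakk>A \<in> Obj (Base P); B \<in> Obj (Base P); f \<in> Hom (Base P) A B; b \<in> carrier (Fib P B)\<rbrakk>
    \<Longrightarrow> Reidx P A B f b \<in> carrier (Fib P A)"
  using Reidx_closed by blast

lemma weaken_closed [simp]: "A \<in> Obj (Base P) \<Longrightarrow> weaken A \<in> carrier (Fib P (times_X A))"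
  unfolding kleisli_weaken_def by (intro Reidx_mem) (simp_all add: X_object \<phi>_closed)

text \<open>A graph commutes with the projections to \<open>X\<close>, so pulling \<phi> back along
  it changes nothing. Hence reindexing restricts to the ideals and preserves their tops.\<close>

lemma Reidx_graph_weaken:
  assumes "A \<in> Obj (Base P)" "B \<in> Obj (Base P)" "g \<in> Hom (Base P) (times_X A) B"
  shows "Reidx P (times_X A) (times_X B) (graph A B g) (weaken B) = weaken A"
  unfolding kleisli_weaken_def using assms
  by (subst Reidx_Comp[symmetric]) (simp_all add: graph_closed Pr1_graph X_object \<phi>_closed)

lemma Reidx_graph_mono:
  assumes "A \<in> Obj (Base P)" "B \<in> Obj (Base P)" "g \<in> Hom (Base P) (times_X A) B"
    and "a \<in> carrier (Fib P (times_X B))" "b \<in> carrier (Fib P (times_X B))"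
    and "a \<sqsubseteq>\<^bsub>Fib P (times_X B)\<^esub> b"
  shows "Reidx P (times_X A) (times_X B) (graph A B g) a \<sqsubseteq>\<^bsub>Fib P (times_X A)\<^esub>
    Reidx P (times_X A) (times_X B) (graph A B g) b"
  using assms by (intro use_iso2[OF Reidx_mono]) (simp_all add: graph_closed)

lemma Reidx_K_mem:
  assumes "A \<in> Obj (Base P)" "B \<in> Obj (Base P)" "g \<in> Hom (Base P) (times_X A) B"
    and "b \<in> carrier (Fib K B)"
  shows "Reidx P (times_X A) (times_X B) (graph A B g) b \<in> carrier (Fib K A)"
  using assms Reidx_graph_mono[of A B g b "weaken B"]
  by (simp add: Reidx_graph_weaken Reidx_mem graph_closed)

lemma Fib_K_poset: "A \<in> Obj (Base P) \<Longrightarrow> partial_order (Fib K A)"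
  unfolding Fib_K by (simp add: partial_order.ideal_below_partial_order Fib_poset)

lemma Fib_K_meets: "A \<in> Obj (Base P) \<Longrightarrow> lower_semilattice (Fib K A)"
  unfolding Fib_K by (simp add: lower_semilattice.ideal_below_lower_semilattice Fib_meets)

lemma Fib_K_top: "A \<in> Obj (Base P) \<Longrightarrow> weak_partial_order_top (Fib K A)"
  unfolding Fib_K by (simp add: partial_order.ideal_below_top Fib_poset)

lemma top_Fib_K: "A \<in> Obj (Base P) \<Longrightarrow> \<top>\<^bsub>Fib K A\<^esub> = weaken A"
  unfolding Fib_K by (simp add: partial_order.top_ideal_below Fib_poset)

lemma meet_Fib_K:
  "\<lbrakk>A \<in> Obj (Base P); a \<in> carrier (Fib K A); b \<in> carrier (Fib K A)\<rbrakk>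
    \<Longrightarrow> a \<sqinter>\<^bsub>Fib K A\<^esub> b = a \<sqinter>\<^bsub>Fib P (times_X A)\<^esub> b"
  unfolding Fib_K by (simp add: lower_semilattice.meet_ideal_below Fib_meets)

text \<open>Functoriality of reindexing is inherited from \<open>P\<close>, because
  \<open>graph\<close> sends Kleisli identities and composites to those of the base.\<close>

lemma doctrine_kleisli: "doctrine K"
proof (intro doctrine.intro doctrine_axioms.intro)
  fix A B f
  assume "A \<in> Obj (Base K)" "B \<in> Obj (Base K)" "f \<in> Hom (Base K) A B"
  then show "isotone (Fib K B) (Fib K A) (Reidx K A B f)"
    using Fib_K_poset[of A] Fib_K_poset[of B]
    by (auto simp: isotone_def Reidx_K Reidx_graph_mono partial_order_def)
next
  fix A B D f g d
  assume "A \<in> Obj (Base K)" "B \<in> Obj (Base K)" "D \<in> Obj (Base K)"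
    "f \<in> Hom (Base K) A B" "g \<in> Hom (Base K) B D" "d \<in> carrier (Fib K D)"
  then show "Reidx K A D (Comp (Base K) A B D g f) d = Reidx K A B f (Reidx K B D g d)"
    by (simp add: Reidx_K) (simp add: kleisli_category_def graph_Comp_graph graph_closed Reidx_Comp)
next
  fix A a
  assume "A \<in> Obj (Base K)" "a \<in> carrier (Fib K A)"
  then show "Reidx K A A (Id (Base K) A) a = a"
    by (simp add: Reidx_K) (simp add: kleisli_category_def graph_Pr2 Reidx_Id)
next
  fix A B f
  assume "A \<in> Obj (Base K)" "B \<in> Obj (Base K)" "f \<in> Hom (Base K) A B"
  then show "Reidx K A B f \<in> carrier (Fib K B) \<rightarrow> carrier (Fib K A)"
    using Reidx_K_mem by (simp add: Reidx_K Pi_iff del: carrier_Fib_K)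
qed (simp_all add: finite_product_category_kleisli Fib_K_poset)

lemma primary_doctrine_kleisli: "primary_doctrine K"
proof (intro primary_doctrine.intro primary_doctrine_axioms.intro)
  fix A B f a b
  assume "A \<in> Obj (Base K)" "B \<in> Obj (Base K)" "f \<in> Hom (Base K) A B"
    and ab: "a \<in> carrier (Fib K B)" "b \<in> carrier (Fib K B)"
  then have f: "A \<in> Obj (Base P)" "B \<in> Obj (Base P)" "f \<in> Hom (Base P) (times_X A) B"
    by simp_all
  have "Reidx P (times_X A) (times_X B) (graph A B f) (a \<sqinter>\<^bsub>Fib P (times_X B)\<^esub> b) =
      Reidx P (times_X A) (times_X B) (graph A B f) a \<sqinter>\<^bsub>Fib P (times_X A)\<^esub>
      Reidx P (times_X A) (times_X B) (graph A B f) b"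
    using f ab by (simp add: Reidx_meet graph_closed)
  \<comment> \<open>\<open>Reidx_K_mem\<close> places the reindexed elements in the ideal, so
    \<open>meet_Fib_K\<close> applies on both sides.\<close>
  then show "Reidx K A B f (a \<sqinter>\<^bsub>Fib K B\<^esub> b) = Reidx K A B f a \<sqinter>\<^bsub>Fib K A\<^esub> Reidx K A B f b"
    by (simp only: Reidx_K meet_Fib_K f ab Reidx_K_mem)
qed (simp_all add: doctrine_kleisli Fib_K_meets Fib_K_top top_Fib_K Reidx_K Reidx_graph_weaken)

section \<open>The canonical 1-arrow as a primary homomorphism\<close>

lemma Reidx_Pr2_mem:
  "\<lbrakk>A \<in> Obj (Base P); a \<in> carrier (Fib P A)\<rbrakk>
    \<Longrightarrow> Reidx P (times_X A) A (Pr2 (Base P) X A) a \<in> carrier (Fib P (times_X A))"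
  by (rule Reidx_mem) simp_all

lemma kleisli_unit_mem:
  assumes "A \<in> Obj (Base P)" "a \<in> carrier (Fib P A)"
  shows "kleisli_unit P X \<phi> A a \<in> carrier (Fib K A)"
proof -
  interpret F: lower_semilattice "Fib P (times_X A)"
    using assms by (simp add: Fib_meets)
  show ?thesis
    using assms by (simp add: kleisli_unit_def Reidx_Pr2_mem F.meet_left)
qed

lemma kleisli_unit_mono:
  assumes "A \<in> Obj (Base P)" "a \<in> carrier (Fib P A)" "b \<in> carrier (Fib P A)" "a \<sqsubseteq>\<^bsub>Fib P A\<^esub> b"
  shows "kleisli_unit P X \<phi> A a \<sqsubseteq>\<^bsub>Fib P (times_X A)\<^esub> kleisli_unit P X \<phi> A b"
proof -
  interpret F: lower_semilattice "Fib P (times_X A)"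
    using assms by (simp add: Fib_meets)
  have "Reidx P (times_X A) A (Pr2 (Base P) X A) a \<sqsubseteq>\<^bsub>Fib P (times_X A)\<^esub>
      Reidx P (times_X A) A (Pr2 (Base P) X A) b"
    using assms by (intro use_iso2[OF Reidx_mono]) simp_all
  from F.le_trans[OF F.meet_right this] show ?thesis
    using assms by (simp add: kleisli_unit_def Reidx_Pr2_mem F.le_meet_iff F.meet_left)
qed

text \<open>Both sides equal the weakened \<phi> met with the reindexing of \<open>b\<close> along
  \<open>f\<close> after the second projection: the graph of that arrow fixes the weakened \<phi>,
  and its second component is the arrow itself.\<close>

lemma kleisli_unit_natural:
  assumes "A \<in> Obj (Base P)" "B \<in> Obj (Base P)" "f \<in> Hom (Base P) A B" "b \<in> carrier (Fib P B)"
  shows "kleisli_unit P X \<phi> A (Reidx P A B f b) =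
    Reidx K A B (Comp (Base P) (times_X A) A B f (Pr2 (Base P) X A)) (kleisli_unit P X \<phi> B b)"
proof -
  let ?g = "Comp (Base P) (times_X A) A B f (Pr2 (Base P) X A)"
  have g: "?g \<in> Hom (Base P) (times_X A) B"
    using assms by (intro Comp_closed) simp_all
  have "Reidx K A B ?g (kleisli_unit P X \<phi> B b) = weaken A \<sqinter>\<^bsub>Fib P (times_X A)\<^esub>
      Reidx P (times_X A) (times_X B) (graph A B ?g)
        (Reidx P (times_X B) B (Pr2 (Base P) X B) b)"
    using assms g
    by (simp add: Reidx_K kleisli_unit_def Reidx_meet graph_closed Reidx_Pr2_mem Reidx_graph_weaken)
  also have "Reidx P (times_X A) (times_X B) (graph A B ?g)
      (Reidx P (times_X B) B (Pr2 (Base P) X B) b) = Reidx P (times_X A) B ?g b"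
    using assms g by (subst Reidx_Comp[symmetric]) (simp_all add: graph_closed Pr2_graph)
  also have "\<dots> = Reidx P (times_X A) A (Pr2 (Base P) X A) (Reidx P A B f b)"
    using assms by (simp add: Reidx_Comp)
  finally show ?thesis
    by (simp add: kleisli_unit_def)
qed

lemma kleisli_unit_meet:
  assumes A: "A \<in> Obj (Base P)" and a: "a \<in> carrier (Fib P A)" and b: "b \<in> carrier (Fib P A)"
  shows "kleisli_unit P X \<phi> A (a \<sqinter>\<^bsub>Fib P A\<^esub> b) =
    kleisli_unit P X \<phi> A a \<sqinter>\<^bsub>Fib K A\<^esub> kleisli_unit P X \<phi> A b"
proof -
  interpret F: lower_semilattice "Fib P (times_X A)"
    using A by (simp add: Fib_meets)
  have "kleisli_unit P X \<phi> A (a \<sqinter>\<^bsub>Fib P A\<^esub> b) =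
      kleisli_unit P X \<phi> A a \<sqinter>\<^bsub>Fib P (times_X A)\<^esub> kleisli_unit P X \<phi> A b"
    using assms by (simp add: kleisli_unit_def Reidx_meet Reidx_Pr2_mem F.meet_distrib_left[symmetric])
  then show ?thesis
    using A kleisli_unit_mem[OF A a] kleisli_unit_mem[OF A b] by (simp only: meet_Fib_K)
qed

lemma kleisli_unit_top:
  assumes "A \<in> Obj (Base P)"
  shows "kleisli_unit P X \<phi> A \<top>\<^bsub>Fib P A\<^esub> = weaken A"
proof -
  interpret F: lower_semilattice "Fib P (times_X A)"
    using assms by (simp add: Fib_meets)
  interpret T: weak_partial_order_top "Fib P (times_X A)"
    using assms by (simp add: Fib_top)
  show ?thesis
    unfolding kleisli_unit_def using assms by (intro F.meet_eqI) (simp_all add: Reidx_top)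
qed

lemma primary_homomorphism_kleisli_unit:
  "primary_homomorphism P K (kleisli_functor (Base P) X) (kleisli_unit P X \<phi>)"
proof -
  interpret KD: primary_doctrine K
    by (rule primary_doctrine_kleisli)
  interpret KF: finite_product_functor "Base P" "Base K" "kleisli_functor (Base P) X"
    by (simp add: finite_product_functor_kleisli)
  have ObjMap [simp]: "ObjMap (kleisli_functor (Base P) X) A = A" for A
    by (simp add: kleisli_functor_def)
  show ?thesis
  proof
    fix A
    assume A: "A \<in> Obj (Base P)"
    then show "kleisli_unit P X \<phi> A \<in>
        carrier (Fib P A) \<rightarrow> carrier (Fib K (ObjMap (kleisli_functor (Base P) X) A))"
      using kleisli_unit_mem by (simp add: Pi_iff del: carrier_Fib_K)
    show "isotone (Fib P A) (Fib K (ObjMap (kleisli_functor (Base P) X) A)) (kleisli_unit P X \<phi> A)"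
      using A Fib_poset[OF A] Fib_K_poset[OF A]
      by (auto simp: isotone_def partial_order_def kleisli_unit_mono)
    show "kleisli_unit P X \<phi> A \<top>\<^bsub>Fib P A\<^esub> =
        \<top>\<^bsub>Fib K (ObjMap (kleisli_functor (Base P) X) A)\<^esub>"
      using A by (simp add: kleisli_unit_top top_Fib_K)
  qed (simp_all add: kleisli_unit_meet kleisli_unit_natural[unfolded Reidx_K] kleisli_functor_def
    Reidx_K)
qed

end

section \<open>Negation on the Kleisli doctrine and its preservation by the unit\<close>

locale kleisli_star_autonomous =
  kleisli_primary P X \<phi> + star_autonomous_doctrine P neg
  for P :: "('o, 'a, 'p) doctrine_data" and X :: 'o and \<phi> :: 'p and neg :: "'o \<Rightarrow> 'p \<Rightarrow> 'p"
begin

lemma kleisli_neg_mem: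
  assumes "A \<in> Obj (Base P)" "a \<in> carrier (Fib P (times_X A))"
  shows "kleisli_neg P neg X \<phi> A a \<in> carrier (Fib K A)"
proof -
  interpret S: star_autonomous_semilattice "Fib P (times_X A)" "neg (times_X A)"
    using assms by (simp add: Fib_star_autonomous)
  show ?thesis
    using assms by (simp add: kleisli_neg_def S.meet_right)
qed

text \<open>The fibrewise laws are those of relativised negation with \<open>w\<close> the weakened
  \<phi>. Naturality holds because reindexing along a graph respects meets, ambient negation and the
  weakened \<phi>.\<close>

lemma star_autonomous_doctrine_kleisli:
  "star_autonomous_doctrine K (kleisli_neg P neg X \<phi>)"
proof -
  interpret KD: primary_doctrine K
    by (rule primary_doctrine_kleisli)
  show ?thesis
  proof
    fix A
    assume "A \<in> Obj (Base K)"
    then have A: "A \<in> Obj (Base P)"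
      by simp
    interpret S: star_autonomous_semilattice "Fib P (times_X A)" "neg (times_X A)"
      using A by (simp add: Fib_star_autonomous)
    interpret KA: partial_order "Fib K A"
      using A by (rule Fib_K_poset)
    show "kleisli_neg P neg X \<phi> A \<in> carrier (Fib K A) \<rightarrow> carrier (Fib K A)"
      using kleisli_neg_mem[OF A] by auto
    show "kleisli_neg P neg X \<phi> A (kleisli_neg P neg X \<phi> A a) = a" if "a \<in> carrier (Fib K A)" for a
      using that A by (simp add: kleisli_neg_def S.relative_neg_neg)
    show "isotone (inv_gorder (Fib K A)) (Fib K A) (kleisli_neg P neg X \<phi> A)"
      using A by (intro isotoneI KA.dual_weak_order KA.weak_partial_order_axioms)
        (simp_all add: kleisli_neg_def S.relative_neg_antitone)
    show "a \<sqinter>\<^bsub>Fib K A\<^esub> b \<sqsubseteq>\<^bsub>Fib K A\<^esub> kleisli_neg P neg X \<phi> A c \<longleftrightarrow>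
        a \<sqsubseteq>\<^bsub>Fib K A\<^esub> kleisli_neg P neg X \<phi> A (b \<sqinter>\<^bsub>Fib K A\<^esub> c)"
      if "a \<in> carrier (Fib K A)" "b \<in> carrier (Fib K A)" "c \<in> carrier (Fib K A)" for a b c
      using that A by (simp add: meet_Fib_K kleisli_neg_def S.meet_le_relative_neg)
  next
    fix A B f b
    assume "A \<in> Obj (Base K)" "B \<in> Obj (Base K)" "f \<in> Hom (Base K) A B" "b \<in> carrier (Fib K B)"
    \<comment> \<open>The ambient negation of \<open>b\<close> may leave the ideal, so
      \<open>Reidx_meet\<close> is applied in the fibre of \<open>P\<close>, where this membership
      is required.\<close>
    moreover from this have "neg (times_X B) b \<in> carrier (Fib P (times_X B))"
      using neg_closed[of "times_X B"] by auto
    ultimately show "kleisli_neg P neg X \<phi> A (Reidx K A B f b) =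
        Reidx K A B f (kleisli_neg P neg X \<phi> B b)"
      by (simp add: kleisli_neg_def Reidx_K Reidx_meet graph_closed Reidx_graph_weaken neg_natural)
  qed
qed

text \<open>Negation commutes with reindexing along the second projection;
  \<open>meet_relative_neg\<close> then absorbs the weakened \<phi> that the unit puts under the
  negation.\<close>

lemma star_autonomous_homomorphism_kleisli_unit:
  "star_autonomous_homomorphism P neg K (kleisli_neg P neg X \<phi>)
    (kleisli_functor (Base P) X) (kleisli_unit P X \<phi>)"
proof -
  interpret KD: star_autonomous_doctrine K "kleisli_neg P neg X \<phi>"
    by (rule star_autonomous_doctrine_kleisli)
  interpret H: primary_homomorphism P K "kleisli_functor (Base P) X" "kleisli_unit P X \<phi>"
    by (rule primary_homomorphism_kleisli_unit)
  show ?thesis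
  proof
    fix A a
    assume A: "A \<in> Obj (Base P)" and a: "a \<in> carrier (Fib P A)"
    interpret S: star_autonomous_semilattice "Fib P (times_X A)" "neg (times_X A)"
      using A by (simp add: Fib_star_autonomous)
    have "Reidx P (times_X A) A (Pr2 (Base P) X A) (neg A a) =
        neg (times_X A) (Reidx P (times_X A) A (Pr2 (Base P) X A) a)"
      using A a by (simp add: neg_natural)
    then show "kleisli_unit P X \<phi> A (neg A a) = kleisli_neg P neg X \<phi>
        (ObjMap (kleisli_functor (Base P) X) A) (kleisli_unit P X \<phi> A a)"
      using A a
      by (simp add: kleisli_unit_def kleisli_neg_def kleisli_functor_def S.meet_relative_neg
        Reidx_Pr2_mem meet_comm[of _ "weaken A" "neg _ _"])
  qed
qed

end

theorem proposition5p13: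
  fixes P :: "('o, 'a, 'p) doctrine_data" and X :: 'o and \<phi> :: 'p and neg :: "'o \<Rightarrow> 'p \<Rightarrow> 'p"
  assumes "primary_doctrine P"
    and "X \<in> Obj (Base P)"
    and "\<phi> \<in> carrier (Fib P X)"
    and "star_autonomous_doctrine P neg"
  shows "star_autonomous_doctrine (kleisli_doctrine P X \<phi>) (kleisli_neg P neg X \<phi>)
    \<and> star_autonomous_homomorphism P neg (kleisli_doctrine P X \<phi>) (kleisli_neg P neg X \<phi>)
        (kleisli_functor (Base P) X) (kleisli_unit P X \<phi>)"
proof -
  interpret kleisli_star_autonomous P X \<phi> neg
    using assms by (simp add: kleisli_star_autonomous_def kleisli_primary_def
      kleisli_primary_axioms_def)
  show ?thesis
    using star_autonomous_doctrine_kleisli star_autonomous_homomorphism_kleisli_unit ..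
qed

end
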